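(* Let $AB$ be a fixed line segment and $Y$ a given rectangle. For each possible area, consider a rectangle $AB_-C_-D$ of that area applied to a part $AB_-$ of $AB$ and deficient by a rectangle $B_-BCC_-$ similar to $Y$; let $AIHG$ be the square of equal area, similarly situated to $AB_-C_-D$ with a corner at $A$, and let $J$ be the point at which the boundaries of $AIHG$ and $AB_-C_-D$ (extended if $AB_-<B_-C_-$) meet, as specified in the context. For all possible areas applied to a part of the fixed line segment $AB$ in the form of a rectangle $AB_-C_-D$, the point $J$ traces out an elliptic curve.
   Context: A rectangle $AB_-C_-D$ is applied to a segment $AB$ deficient by a rectangle similar to a given rectangle $Y$ if its base is a part $AB_-$ of $AB$ and the rectangle $B_-BCC_-$ of the same height $AD=B_-C_-$ erected on the remaining part $B_-B$ is similar to $Y$. With $\lambda$ the fixed ratio of the sides of $Y$, this means $B_-B=\lambda\cdot AD$. Writing $L$ for the length of $AB$, the possible areas are those not exceeding $L^2/(4\lambda)$. The companion square $AIHG$ has the same area as $AB_-C_-D$, with $I$ on the ray $AB$ and $G$ on the ray $AD$. The point $J$ is the intersection of the side $IH$ of the square with the top side $DC_-$ of the rectangle; if $AB_-<B_-C_-$ these sides have to be extended in order to meet. Thus the distance of $J$ from the line $AD$ is $AI$ and its distance from the line $AB$ is $AD$. The segment $AB$ and the rectangle $Y$ are fixed while the applied rectangle, equivalently its height $AD$, varies. "Elliptic curve" refers to the conic called the ellipse. *)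

theory Defs
  imports "HOL-Analysis.Analysis"
begin

type_synonym point = "real ^ 2"

text \<open>Vertices are listed in cyclic order.\<close>
type_synonym quadrilateral = "point \<times> point \<times> point \<times> point"

fun is_rectangle :: "quadrilateral \<Rightarrow> bool" where
  "is_rectangle (P, Q, R, S) \<longleftrightarrow>
     P \<noteq> Q \<and> P \<noteq> S \<and> orthogonal (Q - P) (S - P) \<and> R - S = Q - P"

fun is_square :: "quadrilateral \<Rightarrow> bool" where
  "is_square (P, Q, R, S) \<longleftrightarrow> is_rectangle (P, Q, R, S) \<and> dist P Q = dist P S"

text \<open>Meaningful for rectangles only.\<close>
fun rectangle_area :: "quadrilateral \<Rightarrow> real" where
  "rectangle_area (P, Q, R, S) = dist P Q * dist P S"

text \<open>Similarity respects the labelling of the vertices; for rectangles this fixes which side of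
  one corresponds to which side of the other.\<close>
fun similar_quadrilaterals :: "quadrilateral \<Rightarrow> quadrilateral \<Rightarrow> bool" where
  "similar_quadrilaterals (P, Q, R, S) (P', Q', R', S') \<longleftrightarrow>
     (\<exists>k>0. dist P Q = k * dist P' Q' \<and> dist Q R = k * dist Q' R' \<and>
            dist R S = k * dist R' S' \<and> dist S P = k * dist S' P' \<and>
            dist P R = k * dist P' R' \<and> dist Q S = k * dist Q' S')"

fun side_ratio :: "quadrilateral \<Rightarrow> real" where
  "side_ratio (P, Q, R, S) = dist P Q / dist Q R"

definition ray :: "point \<Rightarrow> point \<Rightarrow> point set" where
  "ray P Q = {P + t *\<^sub>R (Q - P) | t. t \<ge> 0}"

text \<open>The rectangle \<open>(A, B', C', D)\<close> is applied to the segment \<open>AB\<close>, deficient by a rectangle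
  \<open>(B', B, C, C')\<close> similar to \<open>Y\<close>. The ray \<open>AU\<close>, perpendicular to \<open>AB\<close>, selects the side of
  \<open>AB\<close> on which everything is erected.\<close>
definition applied_deficient ::
    "point \<Rightarrow> point \<Rightarrow> point \<Rightarrow> quadrilateral \<Rightarrow> point \<Rightarrow> point \<Rightarrow> point \<Rightarrow> bool" where
  "applied_deficient A B U Y B' C' D \<longleftrightarrow>
     B' \<in> open_segment A B \<and> D \<in> ray A U \<and> is_rectangle (A, B', C', D) \<and>
     (\<exists>C. is_rectangle (B', B, C, C') \<and> similar_quadrilaterals (B', B, C, C') Y)"

definition possible_areas :: "point \<Rightarrow> point \<Rightarrow> quadrilateral \<Rightarrow> real set" where
  "possible_areas A B Y = {0 <.. (dist A B)\<^sup>2 / (4 * side_ratio Y)}"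

text \<open>All positions of the point \<open>J\<close> belonging to the area \<open>S\<close>. In general there are two of them,
  since two applied rectangles of different heights have the same area. The affine hulls are the
  side \<open>IH\<close> of the square and the side \<open>DC'\<close> of the rectangle, both extended.\<close>
definition meeting_points ::
    "point \<Rightarrow> point \<Rightarrow> point \<Rightarrow> quadrilateral \<Rightarrow> real \<Rightarrow> point set" where
  "meeting_points A B U Y S =
     {J. \<exists>B' C' D I H G.
           applied_deficient A B U Y B' C' D \<and> rectangle_area (A, B', C', D) = S \<and>
           I \<in> ray A B \<and> G \<in> ray A D \<and>
           is_square (A, I, H, G) \<and> rectangle_area (A, I, H, G) = S \<and>
           J \<in> affine hull {I, H} \<and> J \<in> affine hull {D, C'}}"

text \<open>The ellipse with foci \<open>F\<close>, \<open>F'\<close> and major semi-axis \<open>a\<close>, provided that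
  \<open>dist F F' < 2 * a\<close>. Circles (\<open>F = F'\<close>) are included; they occur when \<open>Y\<close> is a square.\<close>
definition ellipse :: "point \<Rightarrow> point \<Rightarrow> real \<Rightarrow> point set" where
  "ellipse F F' a = {P. dist P F + dist P F' = 2 * a}"

end

theory Submission
  imports Defs
begin

text \<open>
  Take coordinates along \<open>AB\<close> and \<open>AU\<close>; let \<open>L\<close> be the length of \<open>AB\<close> and \<open>\<lambda>\<close> the side ratio
  of \<open>Y\<close>. If the applied rectangle has height \<open>h\<close>, its base is \<open>L - \<lambda> h\<close>, so the side \<open>x\<close> of the equal square satisfies \<open>x\<^sup>2 = h (L - \<lambda> h)\<close> and \<open>J = (x, h)\<close>.
  Hence \<open>J\<close> lies on the conic \<open>x\<^sup>2 + \<lambda> (y - L / (2 \<lambda>))\<^sup>2 = L\<^sup>2 / (4 \<lambda>)\<close>, which is an ellipse, and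
  every point of this conic with \<open>x > 0\<close> arises. The foci lie on the line through the centre
  \<open>(0, L / (2 \<lambda>))\<close> parallel to \<open>AB\<close> or on the line \<open>AU\<close>, according as \<open>\<lambda> \<ge> 1\<close> or \<open>\<lambda> < 1\<close>.
\<close>

section \<open>The focal definition of an ellipse as a quadratic equation\<close>

text \<open>For the focal distances \<open>u\<close> and \<open>w\<close>, the difference of squares
  is 4 (P - M) \<bullet> v. A sum 2a therefore forces u = a + t and w = a - t with t = ((P - M)
  \<bullet> v) / a, and squaring gives the equation. The coordinate-free form serves either
  direction of the major axis, and v = 0 gives the circle.\<close>

lemma sum_dist_foci_eq_iff:
  fixes P M v :: "'a::real_inner"
  assumes "norm v < a"
  shows "dist P (M - v) + dist P (M + v) = 2 * a \<longleftrightarrow>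
    a\<^sup>2 * ((norm (P - M))\<^sup>2 + (norm v)\<^sup>2) = a ^ 4 + ((P - M) \<bullet> v)\<^sup>2"
proof -
  define X where "X = P - M"
  define u where "u = norm (X + v)"
  define w where "w = norm (X - v)"
  define t where "t = (X \<bullet> v) / a"
  have a: "a > 0" using assms norm_ge_zero[of v] by linarith
  have Xv: "X \<bullet> v = a * t" using a by (simp add: t_def)
  have u2: "u\<^sup>2 = (norm X)\<^sup>2 + (norm v)\<^sup>2 + 2 * (a * t)"
    unfolding u_def Xv[symmetric] power2_norm_eq_inner
    by (simp add: inner_add_left inner_add_right inner_commute)
  have w2: "w\<^sup>2 = (norm X)\<^sup>2 + (norm v)\<^sup>2 - 2 * (a * t)"
    unfolding w_def Xv[symmetric] power2_norm_eq_inner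
    by (simp add: inner_diff_left inner_diff_right inner_commute)
  have "dist P (M - v) = u" "dist P (M + v) = w"
    by (simp_all add: dist_norm u_def w_def X_def algebra_simps)
  moreover have "a\<^sup>2 * ((norm X)\<^sup>2 + (norm v)\<^sup>2) = a ^ 4 + (X \<bullet> v)\<^sup>2 \<longleftrightarrow>
      (norm X)\<^sup>2 + (norm v)\<^sup>2 = a\<^sup>2 + t\<^sup>2"
  proof -
    have "a ^ 4 + (X \<bullet> v)\<^sup>2 = a\<^sup>2 * (a\<^sup>2 + t\<^sup>2)"
      unfolding Xv by algebra
    then show ?thesis using a by simp
  qed
  moreover have "u + w = 2 * a \<longleftrightarrow> (norm X)\<^sup>2 + (norm v)\<^sup>2 = a\<^sup>2 + t\<^sup>2"
  proof
    assume s: "u + w = 2 * a"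
    have "(2 * a) * (u - w) = (2 * a) * (2 * t)"
      unfolding s[symmetric] using u2 w2 s by algebra
    then have "u - w = 2 * t" using a by simp
    then have "u = a + t" using s by simp
    then show "(norm X)\<^sup>2 + (norm v)\<^sup>2 = a\<^sup>2 + t\<^sup>2"
      using u2 by (simp add: power2_sum)
  next
    assume e: "(norm X)\<^sup>2 + (norm v)\<^sup>2 = a\<^sup>2 + t\<^sup>2"
    have va: "(norm v)\<^sup>2 < a\<^sup>2" using assms by (simp add: power_strict_mono)
    have "(a * t)\<^sup>2 \<le> (norm X)\<^sup>2 * (norm v)\<^sup>2"
      unfolding Xv[symmetric] power2_norm_eq_inner by (rule Cauchy_Schwarz_ineq)
    also have "(norm X)\<^sup>2 = a\<^sup>2 + t\<^sup>2 - (norm v)\<^sup>2" using e by simp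
    finally have "t\<^sup>2 * (a\<^sup>2 - (norm v)\<^sup>2) \<le> (norm v)\<^sup>2 * (a\<^sup>2 - (norm v)\<^sup>2)"
      by (simp add: algebra_simps power_mult_distrib)
    then have "t\<^sup>2 \<le> (norm v)\<^sup>2" using va by simp
    then have "\<bar>t\<bar> \<le> norm v" by (simp add: abs_le_square_iff[symmetric])
    then have t: "\<bar>t\<bar> \<le> a" using assms by simp
    have "u\<^sup>2 = (a + t)\<^sup>2" "w\<^sup>2 = (a - t)\<^sup>2"
      using u2 w2 e by (simp_all add: power2_sum power2_diff)
    then have "u = a + t" "w = a - t"
      using t by (auto simp: u_def w_def intro!: power2_eq_imp_eq)
    then show "u + w = 2 * a" by simp
  qed
  ultimately show ?thesis by (simp add: X_def)
qed

section \<open>Rectangles and their similarity\<close>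

lemma rectangle_dist:
  assumes "is_rectangle (P, Q, R, S)"
  shows "dist R S = dist P Q" "dist Q R = dist P S"
    "dist P R = sqrt ((dist P Q)\<^sup>2 + (dist P S)\<^sup>2)"
    "dist Q S = sqrt ((dist P Q)\<^sup>2 + (dist P S)\<^sup>2)"
proof -
  have R: "R = Q + S - P" and o: "(Q - P) \<bullet> (S - P) = 0"
    using assms by (auto simp: orthogonal_def algebra_simps)
  show "dist R S = dist P Q" "dist Q R = dist P S"
    by (simp_all add: R dist_norm norm_minus_commute)
  have "(dist P R)\<^sup>2 = (dist P Q)\<^sup>2 + (dist P S)\<^sup>2"
  proof -
    have "dist P R = norm ((Q - P) + (S - P))"
      unfolding R dist_norm by (subst norm_minus_commute) (simp add: algebra_simps)
    then show ?thesis
      using norm_add_Pythagorean[of "Q - P" "S - P"] o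
      by (simp add: orthogonal_def dist_norm norm_minus_commute)
  qed
  then show "dist P R = sqrt ((dist P Q)\<^sup>2 + (dist P S)\<^sup>2)"
    by (metis real_sqrt_unique zero_le_dist)
  have "(dist Q S)\<^sup>2 = (dist P Q)\<^sup>2 + (dist P S)\<^sup>2"
  proof -
    have "dist Q S = norm ((Q - P) + (- (S - P)))"
      by (simp add: dist_norm)
    then show ?thesis
      using norm_add_Pythagorean[of "Q - P" "- (S - P)"] o
      by (simp add: orthogonal_def dist_norm norm_minus_commute inner_minus_right del: minus_diff_eq)
  qed
  then show "dist Q S = sqrt ((dist P Q)\<^sup>2 + (dist P S)\<^sup>2)"
    by (metis real_sqrt_unique zero_le_dist)
qed

lemma side_ratio_pos: "is_rectangle Y \<Longrightarrow> 0 < side_ratio Y"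
  by (cases Y) (use rectangle_dist(2) in auto)

text \<open>Opposite sides are equal, and by Pythagoras the diagonals scale with the sides. The six
  distance conditions thus collapse to one proportion of adjacent sides.\<close>

lemma similar_rectangles_iff:
  assumes X: "is_rectangle (P, Q, R, S)" and Y: "is_rectangle Y"
  shows "similar_quadrilaterals (P, Q, R, S) Y \<longleftrightarrow> dist P Q = side_ratio Y * dist P S"
proof (cases Y)
  case (fields P' Q' R' S')
  note X' = rectangle_dist[OF X]
  note Y' = rectangle_dist[OF Y[unfolded fields]]
  have pos: "dist P Q > 0" "dist P S > 0" "dist P' Q' > 0" "dist P' S' > 0"
    using X Y fields by auto
  show ?thesis
  proof
    assume "similar_quadrilaterals (P, Q, R, S) Y"
    then obtain k where "k > 0" "dist P Q = k * dist P' Q'" "dist P S = k * dist P' S'"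
      using fields X' Y' by auto
    then show "dist P Q = side_ratio Y * dist P S"
      using pos fields Y' by simp
  next
    assume e: "dist P Q = side_ratio Y * dist P S"
    define k where "k = dist P S / dist P' S'"
    have k: "k > 0" using pos by (simp add: k_def)
    have k1: "dist P S = k * dist P' S'" using pos by (simp add: k_def)
    have k2: "dist P Q = k * dist P' Q'" using e fields Y' pos by (simp add: k_def)
    have "sqrt ((dist P Q)\<^sup>2 + (dist P S)\<^sup>2) = k * sqrt ((dist P' Q')\<^sup>2 + (dist P' S')\<^sup>2)"
      unfolding k1 k2 power_mult_distrib distrib_left[symmetric]
      using k by (simp add: real_sqrt_mult)
    then show "similar_quadrilaterals (P, Q, R, S) Y"
      unfolding fields similar_quadrilaterals.simps X' Y' dist_commute[of S P] dist_commute[of S' P']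
      using k k1 k2 by blast
  qed
qed

section \<open>Coordinates in an orthonormal frame\<close>

text \<open>Nonzero orthogonal vectors are independent, and two independent vectors span the plane
  because its dimension is 2.\<close>

lemma orthonormal_pair_expand:
  fixes e f x :: point
  assumes "norm e = 1" "norm f = 1" "e \<bullet> f = 0"
  shows "x = (x \<bullet> e) *\<^sub>R e + (x \<bullet> f) *\<^sub>R f"
proof -
  have ne: "e \<noteq> f" using assms by (auto simp: norm_eq_1)
  have po: "pairwise orthogonal {e, f}"
    using assms by (auto simp: pairwise_def orthogonal_def inner_commute)
  have "independent {e, f}"
    using assms by (intro pairwise_orthogonal_independent[OF po]) auto
  then have "UNIV \<subseteq> span {e, f}"
    using ne by (intro card_ge_dim_independent) (auto simp: dim_UNIV)
  then have "(\<Sum>v\<in>{e, f}. (x \<bullet> v) *\<^sub>R v) = x"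
    using assms by (intro orthonormal_basis_expand[OF po]) auto
  then show ?thesis using ne by simp
qed

text \<open>Working in an arbitrary frame at \<open>A\<close> avoids moving the figure into standard
  position by an isometry.\<close>

locale frame =
  fixes A e f :: point
  assumes norm_e: "norm e = 1" and norm_f: "norm f = 1" and e_f: "e \<bullet> f = 0"
begin

definition pt :: "real \<Rightarrow> real \<Rightarrow> point" where
  "pt x y = A + x *\<^sub>R e + y *\<^sub>R f"

lemma inner_frame [simp]: "e \<bullet> e = 1" "f \<bullet> f = 1" "e \<bullet> f = 0" "f \<bullet> e = 0"
  using norm_e norm_f e_f by (auto simp: norm_eq_1 inner_commute)

lemma pt_origin: "pt 0 0 = A"
  by (simp add: pt_def)

lemma pt_diff: "pt x y - pt x' y' = (x - x') *\<^sub>R e + (y - y') *\<^sub>R f"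
  by (simp add: pt_def algebra_simps)

lemma inner_pt_diff:
  "(pt x y - pt x' y') \<bullet> (pt u v - pt u' v') = (x - x') * (u - u') + (y - y') * (v - v')"
  by (simp add: pt_diff inner_add_left inner_add_right)

lemma dist_pt: "dist (pt x y) (pt x' y') = sqrt ((x - x')\<^sup>2 + (y - y')\<^sup>2)"
  by (simp add: dist_norm norm_eq_sqrt_inner inner_pt_diff power2_eq_square)

lemma pt_eq_iff [simp]: "pt x y = pt x' y' \<longleftrightarrow> x = x' \<and> y = y'"
  by (metis dist_eq_0_iff dist_pt real_sqrt_eq_zero_cancel_iff right_minus_eq sum_power2_eq_zero_iff)

lemma pt_cases: obtains x y where "P = pt x y"
proof
  show "P = pt ((P - A) \<bullet> e) ((P - A) \<bullet> f)"
    using orthonormal_pair_expand[OF norm_e norm_f e_f, of "P - A"]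
    by (simp add: pt_def algebra_simps)
qed

lemma pt_combine: "pt x y + t *\<^sub>R (pt x' y' - pt x'' y'') = pt (x + t * (x' - x'')) (y + t * (y' - y''))"
  by (simp add: pt_def algebra_simps)

lemma pt_affine:
  assumes "u + v = 1"
  shows "u *\<^sub>R pt x y + v *\<^sub>R pt x' y' = pt (u * x + v * x') (u * y + v * y')"
proof -
  have "u *\<^sub>R A + v *\<^sub>R A = A" by (simp add: assms flip: scaleR_left_distrib)
  then show ?thesis by (simp add: pt_def algebra_simps)
qed

lemma ray_e: "0 < L \<Longrightarrow> ray (pt 0 0) (pt L 0) = {pt x 0 | x. x \<ge> 0}"
  unfolding ray_def pt_combine
  by (auto, metis less_eq_real_def mult.commute nonzero_eq_divide_eq divide_nonneg_pos less_irrefl)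

lemma ray_f: "0 < L \<Longrightarrow> ray (pt 0 0) (pt 0 L) = {pt 0 x | x. x \<ge> 0}"
  unfolding ray_def pt_combine
  by (auto, metis less_eq_real_def mult.commute nonzero_eq_divide_eq divide_nonneg_pos less_irrefl)

text \<open>The fourth vertex is left free, so the rule serves both to compute it from the other
  three and to certify a rectangle.\<close>

lemma is_rectangle_pt:
  "is_rectangle (pt x y, pt (x + w) y, R, pt x (y + h)) \<longleftrightarrow>
     w \<noteq> 0 \<and> h \<noteq> 0 \<and> R = pt (x + w) (y + h)"
proof -
  have "R - pt x (y + h) = pt (x + w) y - pt x y \<longleftrightarrow> R = pt (x + w) (y + h)"
    by (auto simp: pt_def algebra_simps)
  then show ?thesis by (auto simp: orthogonal_def inner_pt_diff)
qed

section \<open>The applied rectangles and the locus in coordinates\<close>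

text \<open>The height is the only freedom: similarity to \<open>Y\<close> makes the missing base
  \<open>side_ratio Y * h\<close>, and the bound on it says that a proper base remains.\<close>

lemma applied_deficient_iff:
  assumes "0 < L" "0 < r" and Y: "is_rectangle Y"
  shows "applied_deficient (pt 0 0) (pt L 0) (pt 0 r) Y B' C' D \<longleftrightarrow>
    (\<exists>h>0. side_ratio Y * h < L \<and> B' = pt (L - side_ratio Y * h) 0 \<and>
       C' = pt (L - side_ratio Y * h) h \<and> D = pt 0 h)"
    (is "?l \<longleftrightarrow> ?r")
proof
  assume ?l
  then obtain C where B': "B' \<in> open_segment (pt 0 0) (pt L 0)" and D: "D \<in> ray (pt 0 0) (pt 0 r)"
    and R: "is_rectangle (pt 0 0, B', C', D)" and R': "is_rectangle (B', pt L 0, C, C')"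
    and sim: "similar_quadrilaterals (B', pt L 0, C, C') Y"
    unfolding applied_deficient_def by blast
  obtain t where t: "0 < t" "t < 1" "B' = (1 - t) *\<^sub>R pt 0 0 + t *\<^sub>R pt L 0"
    using B' by (auto simp: in_segment)
  define w where "w = t * L"
  have w: "B' = pt w 0" "0 < w" "w < L"
    using t \<open>0 < L\<close> by (auto simp: w_def pt_affine)
  obtain h where h: "h \<ge> 0" "D = pt 0 h" using D \<open>0 < r\<close> by (auto simp: ray_f)
  have C': "C' = pt w h" "h > 0"
    using R is_rectangle_pt[of 0 0 w C' h] h w by auto
  have "dist (pt w 0) (pt L 0) = side_ratio Y * dist (pt w 0) (pt w h)"
    using sim similar_rectangles_iff[OF R' Y] unfolding w C' by simp
  then have "L - w = side_ratio Y * h"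
    using w C' by (simp add: dist_pt)
  then have "w = L - side_ratio Y * h" by simp
  then show ?r using w h C' by auto
next
  assume ?r
  then obtain h where h: "h > 0" "side_ratio Y * h < L" "B' = pt (L - side_ratio Y * h) 0"
     "C' = pt (L - side_ratio Y * h) h" "D = pt 0 h" by blast
  define w where "w = L - side_ratio Y * h"
  have w: "0 < w" "w < L" "B' = pt w 0" "C' = pt w h" "L - w = side_ratio Y * h"
    using h side_ratio_pos[OF Y] by (auto simp: w_def)
  have "B' \<in> open_segment (pt 0 0) (pt L 0)"
    unfolding in_segment
    using w(1-3) \<open>0 < L\<close> by (auto intro!: exI[of _ "w / L"] simp: pt_affine)
  moreover have "D \<in> ray (pt 0 0) (pt 0 r)" using h \<open>0 < r\<close> by (auto simp: ray_f)
  moreover have "is_rectangle (pt 0 0, B', C', D)"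
    using is_rectangle_pt[of 0 0 w C' h] h(1,5) w by (simp del: is_rectangle.simps)
  \<comment> \<open>The existentially quantified corner \<open>C\<close> is \<open>pt L h\<close>,
    above \<open>B\<close> at the common height.\<close>
  moreover have R: "is_rectangle (B', pt L 0, pt L h, C')"
    using is_rectangle_pt[of w 0 "L - w" "pt L h" h] h(1) w(1-4) by (simp del: is_rectangle.simps)
  moreover have "similar_quadrilaterals (B', pt L 0, pt L h, C') Y"
    unfolding similar_rectangles_iff[OF R Y] using w h by (simp add: dist_pt)
  ultimately show ?l unfolding applied_deficient_def by blast
qed

text \<open>Extended sides are whole coordinate lines, so \<open>J\<close> is the crossing of a
  vertical and a horizontal line, whichever figure is wider. The line \<open>AU\<close> is also of
  this form.\<close>

lemma affine_hull_vertical: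
  assumes "s \<noteq> 0" shows "affine hull {pt x 0, pt x s} = range (pt x)"
proof -
  have "pt x y = (1 - y / s) *\<^sub>R pt x 0 + (y / s) *\<^sub>R pt x s" for y
    using assms by (simp add: pt_affine left_diff_distrib)
  moreover have "u *\<^sub>R pt x 0 + v *\<^sub>R pt x s = pt x (v * s)" if "u + v = 1" for u v
    using that by (simp add: pt_affine flip: distrib_right)
  ultimately show ?thesis
    unfolding affine_hull_2 by (auto, metis diff_add_cancel)
qed

lemma affine_hull_horizontal:
  assumes "s \<noteq> 0" shows "affine hull {pt 0 y, pt s y} = range (\<lambda>x. pt x y)"
proof -
  have "pt x y = (1 - x / s) *\<^sub>R pt 0 y + (x / s) *\<^sub>R pt s y" for x
    using assms by (simp add: pt_affine left_diff_distrib)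
  moreover have "u *\<^sub>R pt 0 y + v *\<^sub>R pt s y = pt (v * s) y" if "u + v = 1" for u v
    using that by (simp add: pt_affine flip: distrib_right)
  ultimately show ?thesis
    unfolding affine_hull_2 by (auto, metis diff_add_cancel)
qed

text \<open>The side \<open>IH\<close> lies on the vertical line at the side length of the square
  and \<open>DC'\<close> on the horizontal line at the height of the rectangle. Equating the two
  areas leaves one relation between these coordinates.\<close>

lemma meeting_points_eq:
  assumes L: "0 < L" and r: "0 < r" and Y: "is_rectangle Y"
  shows "meeting_points (pt 0 0) (pt L 0) (pt 0 r) Y S =
    {pt s h | s h. 0 < s \<and> 0 < h \<and> side_ratio Y * h < L \<and>
       s\<^sup>2 = h * (L - side_ratio Y * h) \<and> s\<^sup>2 = S}" (is "_ = ?R")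
proof (intro equalityI subsetI)
  fix J assume "J \<in> meeting_points (pt 0 0) (pt L 0) (pt 0 r) Y S"
  then obtain B' C' D I H G where
    ad: "applied_deficient (pt 0 0) (pt L 0) (pt 0 r) Y B' C' D"
    and S: "rectangle_area (pt 0 0, B', C', D) = S" and I: "I \<in> ray (pt 0 0) (pt L 0)" and G: "G \<in> ray (pt 0 0) D"
    and sq: "is_square (pt 0 0, I, H, G)" and S': "rectangle_area (pt 0 0, I, H, G) = S"
    and J1: "J \<in> affine hull {I, H}" and J2: "J \<in> affine hull {D, C'}"
    unfolding meeting_points_def by blast
  obtain h where h: "h > 0" "side_ratio Y * h < L" "B' = pt (L - side_ratio Y * h) 0"
       "C' = pt (L - side_ratio Y * h) h" "D = pt 0 h"
    using ad unfolding applied_deficient_iff[OF L r Y] by blast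
  obtain s where s: "s \<ge> 0" "I = pt s 0" using I L by (auto simp: ray_e)
  obtain g where g: "g \<ge> 0" "G = pt 0 g" using G h by (auto simp: ray_f)
  have "is_rectangle (pt 0 0, I, H, G)" and d: "dist (pt 0 0) I = dist (pt 0 0) G" using sq by simp_all
  then have H: "H = pt s g" "s \<noteq> 0" "g \<noteq> 0"
    using is_rectangle_pt[of 0 0 s H g] s g by auto
  have "g = s" using d s g by (simp add: dist_pt)
  then have J: "J = pt s h"
    using J1 J2 h H s by (auto simp: affine_hull_vertical affine_hull_horizontal)
  have "s\<^sup>2 = S" "h * (L - side_ratio Y * h) = S"
    using S S' s g h \<open>g = s\<close> by (auto simp: dist_pt power2_eq_square)
  then show "J \<in> ?R" using h s H J by auto
next
  fix J assume "J \<in> ?R"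
  then obtain s h where J: "J = pt s h" and s: "s > 0" and h: "h > 0" "side_ratio Y * h < L"
    and s2: "s\<^sup>2 = h * (L - side_ratio Y * h)" "s\<^sup>2 = S"
    by blast
  let ?w = "L - side_ratio Y * h"
  have "applied_deficient (pt 0 0) (pt L 0) (pt 0 r) Y (pt ?w 0) (pt ?w h) (pt 0 h)"
    unfolding applied_deficient_iff[OF L r Y] using h by blast
  moreover have "rectangle_area (pt 0 0, pt ?w 0, pt ?w h, pt 0 h) = S"
    using h s2 by (simp add: dist_pt)
  moreover have "pt s 0 \<in> ray (pt 0 0) (pt L 0)" using L s by (auto simp: ray_e)
  moreover have "pt 0 s \<in> ray (pt 0 0) (pt 0 h)" using h s by (auto simp: ray_f)
  moreover have "is_square (pt 0 0, pt s 0, pt s s, pt 0 s)"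
    using is_rectangle_pt[of 0 0 s "pt s s" s] s unfolding is_square.simps
    by (simp add: dist_pt)
  moreover have "rectangle_area (pt 0 0, pt s 0, pt s s, pt 0 s) = S"
    using s s2(2) by (auto simp: dist_pt power2_eq_square)
  moreover have "J \<in> affine hull {pt s 0, pt s s}" "J \<in> affine hull {pt 0 h, pt ?w h}"
    using s h J by (auto simp: affine_hull_vertical affine_hull_horizontal)
  ultimately show "J \<in> meeting_points (pt 0 0) (pt L 0) (pt 0 r) Y S"
    unfolding meeting_points_def by blast
qed

text \<open>The constraints on height and area disappear: where x > 0, the conic equation makes y (L
  - \<lambda> y) positive, hence 0 < y and \<lambda> y < L, and it also bounds the area.\<close>

lemma Union_meeting_points:
  assumes L: "0 < L" and r: "0 < r" and Y: "is_rectangle Y"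
  shows "(\<Union>S \<in> possible_areas (pt 0 0) (pt L 0) Y. meeting_points (pt 0 0) (pt L 0) (pt 0 r) Y S) =
    {pt x y | x y. 0 < x \<and> x\<^sup>2 = y * (L - side_ratio Y * y)}" (is "?U = ?R")
proof (intro equalityI subsetI)
  fix J assume "J \<in> ?U"
  then show "J \<in> ?R" unfolding meeting_points_eq[OF L r Y] by blast
next
  have pos: "side_ratio Y > 0" by (rule side_ratio_pos[OF Y])
  fix J assume "J \<in> ?R"
  then obtain x y where J: "J = pt x y" and x: "0 < x" and e: "x\<^sup>2 = y * (L - side_ratio Y * y)"
    by blast
  have xx: "y * (L - side_ratio Y * y) > 0" using x e by (metis zero_less_power)
  have y: "0 < y"
  proof (rule ccontr)
    assume "\<not> 0 < y"
    then have "side_ratio Y * y \<le> 0" using pos by (simp add: mult_nonneg_nonpos)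
    then have "y * (L - side_ratio Y * y) \<le> 0"
      using \<open>\<not> 0 < y\<close> L by (intro mult_nonpos_nonneg) auto
    then show False using xx by simp
  qed
  then have "side_ratio Y * y < L" using xx by (simp add: zero_less_mult_iff)
  moreover have "x\<^sup>2 \<in> possible_areas (pt 0 0) (pt L 0) Y"
  proof -
    \<comment> \<open>Completing the square shows that the area is at most L^2 / (4 \<lambda>), with
      equality at y = L / (2 \<lambda>).\<close>
    have "4 * side_ratio Y * x\<^sup>2 = L\<^sup>2 - (L - 2 * side_ratio Y * y)\<^sup>2"
      unfolding e by algebra
    also have "\<dots> \<le> L\<^sup>2" by simp
    finally have "x\<^sup>2 \<le> L\<^sup>2 / (4 * side_ratio Y)"
      using pos by (simp add: pos_le_divide_eq mult.commute)
    then show ?thesis using x by (simp add: possible_areas_def dist_pt)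
  qed
  ultimately show "J \<in> ?U"
    unfolding meeting_points_eq[OF L r Y] using J x y e by blast
qed

section \<open>Foci and axes of the conic\<close>

text \<open>With q = L / (2k), completing the square gives x^2 / (k q^2) + (y - q)^2 / q^2 = 1. The
  semi-axes are sqrt k * q along \<open>e\<close> and q along \<open>f\<close>, and the larger one
  must serve as \<open>a\<close>.\<close>

lemma conic_is_ellipse:
  assumes "0 < L" "0 < k"
  shows "\<exists>F F' a. dist F F' < 2 * a \<and> midpoint F F' \<in> range (pt 0) \<and>
    (\<forall>x y. pt x y \<in> ellipse F F' a \<longleftrightarrow> x\<^sup>2 = y * (L - k * y))"
proof -
  define q where "q = L / (2 * k)"
  have q: "q > 0" "L = 2 * k * q" using assms by (simp_all add: q_def)
  \<comment> \<open>Here \<open>v\<close> is half the vector between the foci around the centre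
    \<open>pt 0 q\<close>. Both directions of the major axis are thereby reduced to the polynomial
    equivalence \<open>key\<close>.\<close>
  have main: ?thesis
    if a: "0 < a" and v: "norm v < a"
      and key: "\<And>x y. a\<^sup>2 * (x\<^sup>2 + (y - q)\<^sup>2 + (norm v)\<^sup>2) = a ^ 4 + ((x *\<^sub>R e + (y - q) *\<^sub>R f) \<bullet> v)\<^sup>2
        \<longleftrightarrow> x\<^sup>2 = y * (L - k * y)" for a v
  proof (intro exI conjI allI)
    show "dist (pt 0 q - v) (pt 0 q + v) < 2 * a"
    proof -
      have "dist (pt 0 q - v) (pt 0 q + v) = norm (2 *\<^sub>R v)"
        unfolding dist_norm by (subst norm_minus_commute) (simp add: scaleR_2)
      then show ?thesis using v by simp
    qed
    have "midpoint (pt 0 q - v) (pt 0 q + v) = pt 0 q"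
      by (simp add: midpoint_def flip: scaleR_2)
    then show "midpoint (pt 0 q - v) (pt 0 q + v) \<in> range (pt 0)" by simp
    fix x y
    have "(norm (pt x y - pt 0 q))\<^sup>2 = x\<^sup>2 + (y - q)\<^sup>2"
      unfolding power2_norm_eq_inner inner_pt_diff by (simp add: power2_eq_square)
    then show "pt x y \<in> ellipse (pt 0 q - v) (pt 0 q + v) a \<longleftrightarrow> x\<^sup>2 = y * (L - k * y)"
      unfolding ellipse_def mem_Collect_eq sum_dist_foci_eq_iff[OF v] key[symmetric]
      by (simp add: pt_diff)
  qed
  show ?thesis
  proof (cases "k \<ge> 1")
    case True
    define a where "a = sqrt k * q"
    \<comment> \<open>The focal half-distance satisfies c^2 = a^2 - q^2, as q is the minor
      semi-axis.\<close>
    define c where "c = sqrt (k - 1) * q"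
    have a2: "a\<^sup>2 = k * q\<^sup>2" and c2: "c\<^sup>2 = (k - 1) * q\<^sup>2"
      using True by (simp_all add: a_def c_def power_mult_distrib)
    have "0 \<le> c" "c < a" using True q by (simp_all add: a_def c_def)
    show ?thesis
    proof (rule main[of a "c *\<^sub>R e"])
      show "0 < a" "norm (c *\<^sub>R e) < a" using \<open>0 \<le> c\<close> \<open>c < a\<close> norm_e by simp_all
      fix x y
      \<comment> \<open>The two equations differ only by the nonzero factor q^2.\<close>
      have "a\<^sup>2 * (x\<^sup>2 + (y - q)\<^sup>2 + c\<^sup>2) - (a ^ 4 + (x * c)\<^sup>2) = q\<^sup>2 * (x\<^sup>2 - y * (L - k * y))"
        using a2 c2 q(2) by algebra
      then have "a\<^sup>2 * (x\<^sup>2 + (y - q)\<^sup>2 + c\<^sup>2) = a ^ 4 + (x * c)\<^sup>2 \<longleftrightarrow> x\<^sup>2 = y * (L - k * y)"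
        using q(1) by (smt (verit) mult_eq_0_iff zero_eq_power2)
      then show "a\<^sup>2 * (x\<^sup>2 + (y - q)\<^sup>2 + (norm (c *\<^sub>R e))\<^sup>2) =
          a ^ 4 + ((x *\<^sub>R e + (y - q) *\<^sub>R f) \<bullet> c *\<^sub>R e)\<^sup>2 \<longleftrightarrow> x\<^sup>2 = y * (L - k * y)"
        by (simp add: norm_e inner_add_left mult.commute)
    qed
  next
    case False
    \<comment> \<open>Now q is the major semi-axis and sqrt k * q the minor one, so the foci lie
      along \<open>f\<close>.\<close>
    define c where "c = sqrt (1 - k) * q"
    have c2: "c\<^sup>2 = (1 - k) * q\<^sup>2"
      using False by (simp add: c_def power_mult_distrib)
    have "0 \<le> c" "c < q" using False q assms by (simp_all add: c_def)
    show ?thesis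
    proof (rule main[of q "c *\<^sub>R f"])
      show "0 < q" "norm (c *\<^sub>R f) < q" using \<open>0 \<le> c\<close> \<open>c < q\<close> norm_f by simp_all
      fix x y
      have "q\<^sup>2 * (x\<^sup>2 + (y - q)\<^sup>2 + c\<^sup>2) - (q ^ 4 + ((y - q) * c)\<^sup>2) = q\<^sup>2 * (x\<^sup>2 - y * (L - k * y))"
        using c2 q(2) by algebra
      then have "q\<^sup>2 * (x\<^sup>2 + (y - q)\<^sup>2 + c\<^sup>2) = q ^ 4 + ((y - q) * c)\<^sup>2 \<longleftrightarrow> x\<^sup>2 = y * (L - k * y)"
        using q(1) by (smt (verit) mult_eq_0_iff zero_eq_power2)
      then show "q\<^sup>2 * (x\<^sup>2 + (y - q)\<^sup>2 + (norm (c *\<^sub>R f))\<^sup>2) =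
          q ^ 4 + ((x *\<^sub>R e + (y - q) *\<^sub>R f) \<bullet> c *\<^sub>R f)\<^sup>2 \<longleftrightarrow> x\<^sup>2 = y * (L - k * y)"
        by (simp add: norm_f inner_add_left mult.commute)
    qed
  qed
qed

end

theorem corollary2:
  fixes A B U :: point and Y :: quadrilateral
  assumes "A \<noteq> B"
    and "is_rectangle Y"
    and "U \<noteq> A" and "orthogonal (U - A) (B - A)"
  shows "\<exists>F F' a. dist F F' < 2 * a \<and> midpoint F F' \<in> affine hull {A, U} \<and>
           (\<Union>S \<in> possible_areas A B Y. meeting_points A B U Y S) =
             {P \<in> ellipse F F' a. (P - A) \<bullet> (B - A) > 0}"
proof -
  define L where "L = norm (B - A)"
  define r where "r = norm (U - A)"
  define e where "e = sgn (B - A)"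
  define f where "f = sgn (U - A)"
  have L: "0 < L" and r: "0 < r" using assms by (simp_all add: L_def r_def)
  interpret frame A e f
    using assms
    by unfold_locales (auto simp: e_def f_def norm_sgn sgn_div_norm orthogonal_def inner_commute)
  have B: "B = pt L 0" and U: "U = pt 0 r"
    using L r unfolding pt_def by (simp_all add: e_def f_def L_def r_def sgn_div_norm)
  obtain F F' a where FF: "dist F F' < 2 * a" "midpoint F F' \<in> range (pt 0)"
    and E: "\<And>x y. pt x y \<in> ellipse F F' a \<longleftrightarrow> x\<^sup>2 = y * (L - side_ratio Y * y)"
    using conic_is_ellipse[OF L side_ratio_pos[OF assms(2)]] by blast
  \<comment> \<open>The centre lies on \<open>AU\<close>, so the inner product condition cuts the
    ellipse exactly in half. The two points of the ellipse on \<open>AU\<close> correspond to the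
    degenerate heights 0 and L / \<lambda>.\<close>
  have "midpoint F F' \<in> affine hull {A, U}"
    using FF(2) affine_hull_vertical[of r 0] r by (simp add: U pt_origin)
  moreover have "(\<Union>S \<in> possible_areas A B Y. meeting_points A B U Y S) =
      {P \<in> ellipse F F' a. (P - A) \<bullet> (B - A) > 0}"
  proof -
    \<comment> \<open>The inner product equals x L, so its sign is that of x.\<close>
    have half: "(pt x y - A) \<bullet> (B - A) > 0 \<longleftrightarrow> x > 0" for x y
      using L using inner_pt_diff[of x y 0 0 L 0 0 0] by (simp add: B pt_origin zero_less_mult_iff)
    have "P \<in> {pt x y | x y. 0 < x \<and> x\<^sup>2 = y * (L - side_ratio Y * y)} \<longleftrightarrow>
        P \<in> ellipse F F' a \<and> (P - A) \<bullet> (B - A) > 0" for P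
      by (rule pt_cases[of P]) (auto simp: E half)
    then show ?thesis
      unfolding B U Union_meeting_points[OF L r assms(2), unfolded pt_origin] by (auto simp: B)
  qed
  ultimately show ?thesis using FF(1) by blast
qed

end
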